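(* Let $\mathfrak a\ge1$ and $\mathfrak b\ge0$ be integers, and let $\Omega$ be a minimal and aperiodic subshift whose language contains infinitely many solutions with parameters $(\mathfrak a,\mathfrak b)$ and which satisfies $\sqrt{\Omega}\subseteq\Omega$. Then $\Omega$ is Sturmian.
   Context: Words are over $\{0,1\}$; an infinite word is a map $\mathbb N\to\{0,1\}$. The language of an infinite word is its set of finite factors. For an extendable and factor-closed language $\mathcal L$, the set of infinite words all of whose finite factors lie in $\mathcal L$ is a subshift; the language of a subshift is the set of all finite factors of its elements. A subshift is minimal if it contains no nonempty subshift as a proper subset, and aperiodic if none of its elements is ultimately periodic. A Sturmian word is an infinite word having exactly $n+1$ distinct factors of each length $n$; a subshift is Sturmian if all words in it are Sturmian. Minimal square roots: $S_1=0$, $S_2=010^{\mathfrak a-1}$, $S_3=010^{\mathfrak a}$, $S_4=10^{\mathfrak a}$, $S_5=10^{\mathfrak a+1}(10^{\mathfrak a})^{\mathfrak b}$, $S_6=10^{\mathfrak a+1}(10^{\mathfrak a})^{\mathfrak b+1}$. Let $\mathcal L(\mathfrak a,\mathfrak b)$ be the set of all finite factors of infinite concatenations of the words $S_5$ and $S_6$. Let $\Pi(\mathfrak a,\mathfrak b)$ be the set of nonempty words in $\mathcal L(\mathfrak a,\mathfrak b)$ that are products $X_1^2\cdots X_n^2$ with all $X_i\in\{S_1,\dots,S_6\}$. A nonempty word $w$ is a solution with parameters $(\mathfrak a,\mathfrak b)$ if $w^2\in\Pi(\mathfrak a,\mathfrak b)$ and $w$ can be written as $w=X_1\cdots X_n$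 with $X_i\in\{S_1,\dots,S_6\}$ such that $X_1^2\cdots X_n^2=(X_1\cdots X_n)^2$. Square root map: an infinite word $\mathbf w$ all of whose factors lie in $\mathcal L(\mathfrak a,\mathfrak b)$ factorizes uniquely as $\mathbf w=X_1^2X_2^2\cdots$ with all $X_i\in\{S_1,\dots,S_6\}$, and its square root is $\sqrt{\mathbf w}=X_1X_2\cdots$. All words of the subshifts $\Omega$ considered in the claim are of this kind, and $\sqrt\Omega=\{\sqrt{\mathbf w}:\mathbf w\in\Omega\}$. *)

theory Defs
  imports Main "HOL-Library.Sublist" "HOL-Library.Omega_Words_Fun" "HOL-Library.Z2"
begin

text \<open>
  Finite words over \<open>{0,1}\<close> are of type \<^typ>\<open>bit list\<close>; infinite words are of type
  \<^typ>\<open>bit word\<close>, that is \<^typ>\<open>nat \<Rightarrow> bit\<close>. The field structure of \<^typ>\<open>bit\<close> plays no role.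
\<close>

subsection \<open>Infinite words and subshifts\<close>

definition factors :: "bit word \<Rightarrow> bit list set" where
  "factors w = {w [i \<rightarrow> j] | i j. True}"

definition ultimately_periodic :: "bit word \<Rightarrow> bool" where
  "ultimately_periodic w \<longleftrightarrow> (\<exists>p>0. \<exists>N. \<forall>n\<ge>N. w (n + p) = w n)"

definition sturmian :: "bit word \<Rightarrow> bool" where
  "sturmian w \<longleftrightarrow> (\<forall>n. card {u \<in> factors w. length u = n} = n + 1)"

definition factor_closed :: "bit list set \<Rightarrow> bool" where
  "factor_closed L \<longleftrightarrow> (\<forall>u\<in>L. \<forall>v. sublist v u \<longrightarrow> v \<in> L)"

text \<open>
  Since infinite words are one-sided, extendability means extendability to the right; with
  factor-closed languages this yields exactly the closed sets of infinite words that are mapped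
  into themselves by the shift.
\<close>

definition extendable :: "bit list set \<Rightarrow> bool" where
  "extendable L \<longleftrightarrow> (\<forall>u\<in>L. \<exists>x. u @ [x] \<in> L)"

definition subshift :: "bit word set \<Rightarrow> bool" where
  "subshift \<Omega> \<longleftrightarrow> (\<exists>L. extendable L \<and> factor_closed L \<and> \<Omega> = {w. factors w \<subseteq> L})"

definition language :: "bit word set \<Rightarrow> bit list set" where
  "language \<Omega> = (\<Union>w\<in>\<Omega>. factors w)"

definition minimal_subshift :: "bit word set \<Rightarrow> bool" where
  "minimal_subshift \<Omega> \<longleftrightarrow> subshift \<Omega> \<and> \<not> (\<exists>\<Omega>'. subshift \<Omega>' \<and> \<Omega>' \<noteq> {} \<and> \<Omega>' \<subset> \<Omega>)"

definition aperiodic :: "bit word set \<Rightarrow> bool" where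
  "aperiodic \<Omega> \<longleftrightarrow> (\<forall>w\<in>\<Omega>. \<not> ultimately_periodic w)"

definition sturmian_subshift :: "bit word set \<Rightarrow> bool" where
  "sturmian_subshift \<Omega> \<longleftrightarrow> subshift \<Omega> \<and> (\<forall>w\<in>\<Omega>. sturmian w)"


subsection \<open>Minimal square roots and solutions\<close>

definition S1 :: "bit list" where
  "S1 = [0]"

definition S2 :: "nat \<Rightarrow> bit list" where
  "S2 a = [0, 1] @ replicate (a - 1) 0"

definition S3 :: "nat \<Rightarrow> bit list" where
  "S3 a = [0, 1] @ replicate a 0"

definition S4 :: "nat \<Rightarrow> bit list" where
  "S4 a = [1] @ replicate a 0"

definition S5 :: "nat \<Rightarrow> nat \<Rightarrow> bit list" where
  "S5 a b = [1] @ replicate (a + 1) 0 @ concat (replicate b ([1] @ replicate a 0))"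

definition S6 :: "nat \<Rightarrow> nat \<Rightarrow> bit list" where
  "S6 a b = [1] @ replicate (a + 1) 0 @ concat (replicate (b + 1) ([1] @ replicate a 0))"

definition minimal_roots :: "nat \<Rightarrow> nat \<Rightarrow> bit list set" where
  "minimal_roots a b = {S1, S2 a, S3 a, S4 a, S5 a b, S6 a b}"

text \<open>
  The infinite concatenation \<open>X 0 @ X 1 @ X 2 @ \<dots>\<close>, meaningful only if no \<open>X i\<close> is empty:
  then the first \<open>n + 1\<close> blocks have total length greater than \<open>n\<close>, so that the \<open>n\<close>-th letter
  can be read off from them.
\<close>

definition inf_concat :: "(nat \<Rightarrow> bit list) \<Rightarrow> bit word" where
  "inf_concat X = (\<lambda>n. concat (map X [0..<Suc n]) ! n)"

definition Lang :: "nat \<Rightarrow> nat \<Rightarrow> bit list set" where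
  "Lang a b = (\<Union>X\<in>{X. range X \<subseteq> {S5 a b, S6 a b}}. factors (inf_concat X))"

definition square_product :: "bit list list \<Rightarrow> bit list" where
  "square_product Xs = concat (map (\<lambda>X. X @ X) Xs)"

definition Pi_lang :: "nat \<Rightarrow> nat \<Rightarrow> bit list set" where
  "Pi_lang a b =
     {w \<in> Lang a b. w \<noteq> [] \<and> (\<exists>Xs. set Xs \<subseteq> minimal_roots a b \<and> w = square_product Xs)}"

definition solution :: "nat \<Rightarrow> nat \<Rightarrow> bit list \<Rightarrow> bool" where
  "solution a b w \<longleftrightarrow> w \<noteq> [] \<and> w @ w \<in> Pi_lang a b \<and>
     (\<exists>Xs. set Xs \<subseteq> minimal_roots a b \<and> w = concat Xs \<and>
           square_product Xs = concat Xs @ concat Xs)"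


subsection \<open>The square root map\<close>

definition square_factorization :: "nat \<Rightarrow> nat \<Rightarrow> bit word \<Rightarrow> (nat \<Rightarrow> bit list) \<Rightarrow> bool" where
  "square_factorization a b w X \<longleftrightarrow>
     range X \<subseteq> minimal_roots a b \<and> w = inf_concat (\<lambda>i. X i @ X i)"

text \<open>
  The square root is meaningful only for words having a unique square factorization; for
  \<open>a \<ge> 1\<close> these include all infinite words whose factors lie in \<^term>\<open>Lang a b\<close>.
\<close>

definition square_root :: "nat \<Rightarrow> nat \<Rightarrow> bit word \<Rightarrow> bit word" where
  "square_root a b w = inf_concat (THE X. square_factorization a b w X)"

end

theory Submission
  imports Defs
begin

text \<open>
  For a word \<open>w\<close> of length \<open>N\<close> with \<open>K\<close> ones put \<open>D(j) = N |w[0,j)|\<^sub>1 - K j\<close>. At the end points \<open>p\<close> of the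
  blocks of a solution \<open>w = X\<^sub>1\<dots>X\<^sub>n\<close> one has \<open>D(2p) = 2D(p)\<close>, so \<open>D\<close> cannot take an extreme value far
  from \<open>0\<close>, and it turns out that \<open>-K \<le> D \<le> N - K\<close>. Dividing by \<open>gcd(N, K)\<close> gives a coprime pair
  \<open>(q, k)\<close> for which the discrepancy stays in \<open>[-k, q-k]\<close>.

  If \<open>q\<close> is unbounded over the solutions in the language, uniform recurrence makes \<open>\<Omega>\<close> balanced: an
  unbalanced pair \<open>0z0\<close>, \<open>1z1\<close> forces the discrepancy to run through the whole interval, whence
  \<open>q\<close> divides \<open>|z| + 2\<close>. Otherwise a single pair \<open>(q, k)\<close> serves for all of \<open>\<Omega>\<close>. Shift a word of \<open>\<Omega>\<close> so that
  its discrepancy starts at an odd value \<open>s\<close>. By the halving argument, \<open>s\<close> plus twice the discrepancy of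
  the square root lies in \<open>[-2k, 2(q-k)]\<close>; being odd it is neither \<open>0\<close> nor an end point, so its sign
  determines the next letter. So the square root is periodic, contrary to aperiodicity.
\<close>

subsection \<open>Discrepancy\<close>

definition disc :: "int \<Rightarrow> int \<Rightarrow> bit list \<Rightarrow> int" where
  "disc q k u = q * int (count_list u 1) - k * int (length u)"

lemma disc_Nil [simp]: "disc q k [] = 0"
  by (simp add: disc_def)

lemma disc_append [simp]: "disc q k (u @ v) = disc q k u + disc q k v"
  by (simp add: disc_def algebra_simps)

lemma disc_Cons_0 [simp]: "disc q k (0 # u) = disc q k u - k"
  by (simp add: disc_def algebra_simps)

lemma disc_Cons_1 [simp]: "disc q k (1 # u) = disc q k u + q - k"
  by (simp add: disc_def algebra_simps)

lemma disc_replicate_0 [simp]: "disc q k (replicate n 0) = - (k * int n)"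
  by (induction n) (simp_all add: algebra_simps)

lemma disc_mult: "disc (g * q) (g * k) u = g * disc q k u"
  by (simp add: disc_def algebra_simps)

section \<open>Discrepancy along prefixes of the minimal roots\<close>

lemma prefix_replicate:
  "Sublist.prefix v (replicate n c) \<Longrightarrow> \<exists>l\<le>n. v = replicate l c"
  using replicate_length_same[of v c] prefix_length_le[of v] set_mono_prefix[of v]
  by (intro exI[of _ "length v"]) fastforce

abbreviation blocks :: "nat \<Rightarrow> nat \<Rightarrow> bit list" where
  "blocks a n \<equiv> concat (replicate n (1 # replicate a 0))"

text \<open>A block 10^a rises by \<open>q - k\<close>, then falls by \<open>a * k\<close> in all,
  and ends no lower than it began because \<open>(a + 1) * k <= q\<close>. So a power is lowest at
  its start, and a prefix exceeds the final value by at most one such fall.\<close>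

lemma prefix_blocks:
  assumes "0 \<le> k" "(int a + 1) * k \<le> q" "Sublist.prefix v (blocks a n)"
  shows "0 \<le> disc q k v \<and> disc q k v \<le> disc q k (blocks a n) + int a * k"
  using assms(3)
proof (induction n arbitrary: v)
  case 0
  then show ?case using assms(1) by simp
next
  case (Suc n)
  have B0: "0 \<le> disc q k (blocks a m)" for m
    using assms(1,2) by (induction m) (auto simp: algebra_simps)
  have D: "disc q k (blocks a (Suc n)) = q - (int a + 1) * k + disc q k (blocks a n)"
    by (simp add: algebra_simps)
  have ak: "0 \<le> int a * k" using assms(1) by simp
  from Suc.prems have "Sublist.prefix v ((1 # replicate a 0) @ blocks a n)" by simp
  then consider "v = []" | l where "l \<le> a" "v = 1 # replicate l 0"
    | v' where "v = (1 # replicate a 0) @ v'" "Sublist.prefix v' (blocks a n)"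
    unfolding prefix_append by (auto simp: prefix_Cons dest!: prefix_replicate)
  then show ?case
  proof cases
    case 1
    then show ?thesis unfolding D using B0[of n] ak assms(2) by simp
  next
    case 2
    have "k * int l \<le> k * int a" using 2 assms(1) by (intro mult_left_mono) auto
    moreover have "0 \<le> k * int l" using assms(1) by simp
    ultimately show ?thesis using 2 assms B0[of n] by (auto simp: algebra_simps)
  next
    case 3
    then show ?thesis using Suc.IH[OF 3(2)] assms(1,2) by (auto simp: algebra_simps)
  qed
qed

lemma minimal_roots_cases:
  assumes "X \<in> minimal_roots a b" "1 \<le> a"
  obtains (S1) "X = [0]"
    | (zero) n where "n = a \<or> n = a - 1" "X = 0 # 1 # replicate n 0"
    | (S4) "X = 1 # replicate a 0"
    | (long) n where "n = b \<or> n = b + 1" "X = 1 # replicate (a + 1) 0 @ blocks a n"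
  using assms unfolding minimal_roots_def S1_def S2_def S3_def S4_def S5_def S6_def
  by (simp only: append.simps) blast

lemma prefix_01_cases:
  assumes "Sublist.prefix v (0 # 1 # replicate n (0::bit))"
  obtains "v = []" | "v = [0]" | l where "l \<le> n" "v = 0 # 1 # replicate l 0"
  using assms by (auto simp: prefix_Cons dest!: prefix_replicate)

lemma prefix_1_cases:
  assumes "Sublist.prefix v (1 # replicate n (0::bit) @ u)"
  obtains "v = []" | l where "l \<le> n" "v = 1 # replicate l 0"
    | v' where "Sublist.prefix v' u" "v = 1 # replicate n 0 @ v'"
  using assms by (auto simp: prefix_Cons prefix_append dest!: prefix_replicate)

text \<open>As \<open>(a + 1) * k <= q\<close>, a letter 1 makes up for itself and a zeros; a prefix
  of a root has at most one 0 beyond that.\<close>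

lemma root_lower:
  assumes "1 \<le> a" "0 \<le> k" "(int a + 1) * k \<le> q" "X \<in> minimal_roots a b" "Sublist.prefix v X"
  shows "- k \<le> disc q k v"
proof -
  have mono: "k * int l \<le> k * int n" if "l \<le> n" for l n
    using that assms(2) by (intro mult_left_mono) auto
  from assms(4,1) show ?thesis
  proof (cases rule: minimal_roots_cases)
    case S1
    then show ?thesis using assms by (auto simp: prefix_Cons)
  next
    case (zero n)
    from assms(5)[unfolded zero(2)] show ?thesis
    proof (cases rule: prefix_01_cases)
      case (3 l)
      then have "l \<le> a" using zero by auto
      then show ?thesis using 3 mono[of l a] assms(2,3) by (auto simp: algebra_simps)
    qed (use assms(2) in auto)
  next
    case S4
    from assms(5)[unfolded S4] have "Sublist.prefix v (1 # replicate a 0 @ [])" by simp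
    then show ?thesis
    proof (cases rule: prefix_1_cases)
      case (2 l)
      then show ?thesis using mono[of l a] assms(2,3) by (auto simp: algebra_simps)
    next
      case (3 v')
      then show ?thesis using assms(2,3) by (auto simp: algebra_simps)
    qed (use assms(2) in auto)
  next
    case (long n)
    from assms(5)[unfolded long(2)] show ?thesis
    proof (cases rule: prefix_1_cases)
      case 1
      then show ?thesis using assms by simp
    next
      case (2 l)
      then show ?thesis using mono[of l "a + 1"] assms by (auto simp: algebra_simps)
    next
      case (3 v')
      then show ?thesis
        using prefix_blocks[OF assms(2,3), of v' n] assms by (auto simp: algebra_simps)
    qed
  qed
qed

text \<open>A prefix with at most one 1 satisfies the first alternative. Only \<open>S5\<close> and
  \<open>S6\<close> can climb further, through their blocks 10^a, but there the value exceeds the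
  final one by at most \<open>a * k <= q - k\<close>.\<close>

lemma root_upper:
  assumes "1 \<le> a" "0 \<le> k" "(int a + 1) * k \<le> q" "X \<in> minimal_roots a b" "Sublist.prefix v X"
  shows "disc q k v \<le> q - k \<or> disc q k v \<le> disc q k X + q - k"
proof -
  have mono: "0 \<le> k * int l" for l
    using assms(2) by simp
  have qk: "k \<le> q"
    using assms(3) mono[of a] by (simp add: algebra_simps)
  from assms(4,1) show ?thesis
  proof (cases rule: minimal_roots_cases)
    case S1
    then show ?thesis using assms qk by (auto simp: prefix_Cons)
  next
    case (zero n)
    from assms(5)[unfolded zero(2)] show ?thesis
      by (cases rule: prefix_01_cases)
        (use qk mono assms in \<open>auto simp: algebra_simps\<close>)+
  next
    case S4
    from assms(5)[unfolded S4] have "Sublist.prefix v (1 # replicate a 0 @ [])" by simp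
    then show ?thesis
      by (cases rule: prefix_1_cases)
        (use qk mono assms in \<open>auto simp: algebra_simps\<close>)+
  next
    case (long n)
    from assms(5)[unfolded long(2)] show ?thesis
    proof (cases rule: prefix_1_cases)
      case 1
      then show ?thesis using qk by simp
    next
      case (2 l)
      then show ?thesis using mono[of l] by auto
    next
      case (3 v')
      then have "disc q k v \<le> disc q k X + int a * k"
        using prefix_blocks[OF assms(2,3), of v' n] long by (auto simp: algebra_simps)
      then show ?thesis using assms(3) by (auto simp: algebra_simps)
    qed
  qed
qed

lemma root_density:
  assumes "1 \<le> a" "X \<in> minimal_roots a b"
  shows "(a + 1) * count_list X 1 \<le> length X"
proof -
  have r: "count_list (replicate n 0) (1::bit) = 0" for n by (induction n) auto
  have bl: "(a + 1) * count_list (blocks a n) 1 = length (blocks a n)" for n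
    by (induction n) (auto simp: r algebra_simps)
  from assms(2,1) show ?thesis
    by (cases rule: minimal_roots_cases) (use assms(1) bl in \<open>auto simp: r algebra_simps\<close>)
qed

text \<open>For a whole solution, with \<open>q\<close> its length and \<open>k\<close> its number
  of ones, this supplies the hypothesis \<open>(a + 1) * k <= q\<close> of the bounds above.\<close>

lemma concat_density:
  assumes "1 \<le> a" "set Xs \<subseteq> minimal_roots a b"
  shows "(a + 1) * count_list (concat Xs) 1 \<le> length (concat Xs)"
  using assms(2)
proof (induction Xs)
  case (Cons X Xs)
  then show ?case using root_density[OF assms(1), of X b] by (simp add: algebra_simps)
qed simp

text \<open>
  Here \<open>s\<close> is twice the discrepancy at which the root \<open>concat Xs\<close> starts. Inside a block \<open>X\<close> the value
  at \<open>v\<close> is compared with the values at both copies of \<open>v\<close> in \<open>X @ X\<close>.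
\<close>

lemma disc_root_upper:
  assumes "1 \<le> a" "0 \<le> k" "(int a + 1) * k \<le> q" "set Xs \<subseteq> minimal_roots a b"
    and "\<And>u. Sublist.prefix u (square_product Xs) \<Longrightarrow> s + disc q k u \<le> M"
    and "Sublist.prefix v (concat Xs)"
  shows "s + 2 * disc q k v \<le> 2 * (q - k) \<or> s + 2 * disc q k v < 2 * M"
  using assms(4-)
proof (induction Xs arbitrary: s v)
  case Nil
  have "0 \<le> int a * k" using assms(2) by simp
  then have "k \<le> q" using assms(3) by (simp add: algebra_simps)
  moreover have "s \<le> M" using Nil(2)[of "[]"] by simp
  \<comment> \<open>If \<open>s > 2 * (q - k)\<close> then \<open>s > 0\<close>, hence
    \<open>2 * M >= 2 * s > s\<close>.\<close>
  ultimately have "s \<le> 2 * (q - k) \<or> s < 2 * M" by (smt (verit))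
  then show ?case using Nil by simp
next
  case (Cons X Xs)
  have sq: "square_product (X # Xs) = X @ X @ square_product Xs"
    by (simp add: square_product_def)
  have "Sublist.prefix v (X @ concat Xs)" using Cons.prems(3) by simp
  then consider "Sublist.prefix v X" | v' where "v = X @ v'" "Sublist.prefix v' (concat Xs)"
    unfolding prefix_append by blast
  then show ?case
  proof cases
    case 1
    have "s + disc q k v \<le> M" "s + disc q k X + disc q k v \<le> M"
      using Cons.prems(2)[of v] Cons.prems(2)[of "X @ v"] 1 unfolding sq by auto
    moreover have "disc q k v \<le> q - k \<or> disc q k v \<le> disc q k X + q - k"
      using root_upper[OF assms(1-3), of X b v] 1 Cons.prems(1) by simp
    \<comment> \<open>Either alternative of \<open>root_upper\<close> gives
      \<open>s + 2 * disc q k v <= M + (q - k)\<close>; the second one uses the second copy of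
      \<open>v\<close>. The right side is at most \<open>2 * (q - k)\<close> if
      \<open>M <= q - k\<close>, and less than \<open>2 * M\<close> otherwise.\<close>
    ultimately show ?thesis by (smt (verit))
  next
    case 2
    have "(s + 2 * disc q k X) + 2 * disc q k v' \<le> 2 * (q - k)
        \<or> (s + 2 * disc q k X) + 2 * disc q k v' < 2 * M"
    proof (rule Cons.IH)
      fix u assume "Sublist.prefix u (square_product Xs)"
      then show "s + 2 * disc q k X + disc q k u \<le> M"
        using Cons.prems(2)[of "X @ X @ u"] unfolding sq by simp
    qed (use Cons.prems 2 in auto)
    then show ?thesis using 2 by (simp add: algebra_simps)
  qed
qed

lemma disc_root_lower:
  assumes "1 \<le> a" "0 \<le> k" "(int a + 1) * k \<le> q" "set Xs \<subseteq> minimal_roots a b"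
    and "\<And>u. Sublist.prefix u (square_product Xs) \<Longrightarrow> m \<le> s + disc q k u"
    and "Sublist.prefix v (concat Xs)"
  shows "- 2 * k \<le> s + 2 * disc q k v \<or> 2 * m < s + 2 * disc q k v"
  using assms(4-)
proof (induction Xs arbitrary: s v)
  case Nil
  then show ?case using Nil(2)[of "[]"] assms(2) by auto
next
  case (Cons X Xs)
  have sq: "square_product (X # Xs) = X @ X @ square_product Xs"
    by (simp add: square_product_def)
  have "Sublist.prefix v (X @ concat Xs)" using Cons.prems(3) by simp
  then consider "Sublist.prefix v X" | v' where "v = X @ v'" "Sublist.prefix v' (concat Xs)"
    unfolding prefix_append by blast
  then show ?case
  proof cases
    case 1
    have "m \<le> s + disc q k v"
      using Cons.prems(2)[of v] 1 unfolding sq by auto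
    moreover have "- k \<le> disc q k v"
      using root_lower[OF assms(1-3), of X b v] 1 Cons.prems(1) by simp
    \<comment> \<open>The sum is at least \<open>m - k\<close>, which is at least
      \<open>- 2 * k\<close> if \<open>m >= - k\<close>, and greater than \<open>2 * m\<close>
      otherwise.\<close>
    ultimately show ?thesis by (smt (verit))
  next
    case 2
    have "- 2 * k \<le> (s + 2 * disc q k X) + 2 * disc q k v'
        \<or> 2 * m < (s + 2 * disc q k X) + 2 * disc q k v'"
    proof (rule Cons.IH)
      fix u assume "Sublist.prefix u (square_product Xs)"
      then show "m \<le> s + 2 * disc q k X + disc q k u"
        using Cons.prems(2)[of "X @ X @ u"] unfolding sq by simp
    qed (use Cons.prems 2 in auto)
    then show ?thesis using 2 by (simp add: algebra_simps)
  qed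
qed

text \<open>A letter 0 respects the bound \<open>- k\<close> only after a value >= 0, a letter 1 the
  bound \<open>q - k\<close> only after a value <= 0. So inside this interval every nonzero value
  determines the next letter.\<close>

definition confined :: "int \<Rightarrow> int \<Rightarrow> int \<Rightarrow> bit list \<Rightarrow> bool" where
  "confined q k s u \<longleftrightarrow> (\<forall>v. Sublist.prefix v u \<longrightarrow> s + disc q k v \<in> {- k..q - k})"

lemma confined_append:
  "confined q k s (u @ v) \<longleftrightarrow> confined q k s u \<and> confined q k (s + disc q k u) v"
  by (auto simp: confined_def prefix_append algebra_simps)

lemma confined_sublist:
  assumes "confined q k s w" "sublist v w"
  obtains s' where "confined q k s' v"
  using assms by (auto simp: sublist_def confined_append)

text \<open>A maximum principle: at a prefix of extreme discrepancy the strict alternatives of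
  \<open>disc_root_upper\<close> and \<open>disc_root_lower\<close> fail, which leaves the bounds
  \<open>N - K\<close> and \<open>- K\<close>. The bound on \<open>q\<close> by the length later
  makes solutions with large \<open>q\<close> long.\<close>

lemma solution_confined:
  assumes "1 \<le> a" "solution a b w"
  obtains q k where "0 \<le> k" "(int a + 1) * k \<le> q" "0 < q" "coprime q k" "q \<le> int (length w)"
    "confined q k 0 w"
proof -
  obtain Xs where Xs: "set Xs \<subseteq> minimal_roots a b" "w = concat Xs" "square_product Xs = w @ w"
    and "w \<noteq> []"
    using assms(2) unfolding solution_def by metis
  define N K where "N = int (length w)" and "K = int (count_list w 1)"
  have "N > 0" "K \<ge> 0" using \<open>w \<noteq> []\<close> by (simp_all add: N_def K_def)
  have NK: "(int a + 1) * K \<le> N"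
  proof -
    have "int ((a + 1) * count_list w 1) \<le> int (length w)"
      using concat_density[OF assms(1) Xs(1)] unfolding Xs(2) of_nat_le_iff .
    then show ?thesis by (simp add: N_def K_def algebra_simps)
  qed
  have w0: "disc N K w = 0" by (simp add: disc_def N_def K_def)
  define P where "P = disc N K ` {v. Sublist.prefix v w}"
  have "P = disc N K ` set (prefixes w)" unfolding P_def set_prefixes_eq ..
  then have fin: "finite P" "P \<noteq> {}" by simp_all
  have bounds: "Min P \<le> 0 + disc N K u \<and> 0 + disc N K u \<le> Max P"
    if "Sublist.prefix u (square_product Xs)" for u
  proof -
    \<comment> \<open>As \<open>disc N K w = 0\<close>, the second copy of \<open>w\<close> repeats
      the values of the first.\<close>
    have "\<exists>v. Sublist.prefix v w \<and> disc N K v = disc N K u"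
      using that w0 unfolding Xs(3) prefix_append by (metis add_0 disc_append)
    then have "disc N K u \<in> P" unfolding P_def by (auto simp: image_iff)
    then show ?thesis using fin by simp
  qed
  have up: "disc N K v \<le> N - K \<or> disc N K v < Max P" if "Sublist.prefix v w" for v
    using disc_root_upper[OF assms(1) \<open>K \<ge> 0\<close> NK Xs(1), of 0 "Max P" v] bounds that
    unfolding Xs(2)[symmetric] by fastforce
  have lo: "- K \<le> disc N K v \<or> Min P < disc N K v" if "Sublist.prefix v w" for v
    using disc_root_lower[OF assms(1) \<open>K \<ge> 0\<close> NK Xs(1), of "Min P" 0 v] bounds that
    unfolding Xs(2)[symmetric] by fastforce
  have "Max P \<le> N - K"
  proof -
    have "Max P \<in> P" using fin by (rule Max_in)
    then obtain v where "Sublist.prefix v w" "Max P = disc N K v" unfolding P_def by blast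
    with up[of v] show ?thesis by simp
  qed
  have "- K \<le> Min P"
  proof -
    have "Min P \<in> P" using fin by (rule Min_in)
    then obtain v where "Sublist.prefix v w" "Min P = disc N K v" unfolding P_def by blast
    with lo[of v] show ?thesis by simp
  qed
  have conf: "- K \<le> disc N K v \<and> disc N K v \<le> N - K" if "Sublist.prefix v w" for v
      proof -
    have "Sublist.prefix v (square_product Xs)" unfolding Xs(3) using that by simp
    from bounds[OF this] \<open>Max P \<le> N - K\<close> \<open>- K \<le> Min P\<close> show ?thesis by linarith
  qed
  \<comment> \<open>Coprimality serves twice: for the divisibility in
    \<open>confined_balanced\<close> and for the parity in
    \<open>confined_odd_shift\<close>.\<close>
  define g where "g = gcd N K"
  have "g > 0" using \<open>N > 0\<close> by (simp add: g_def)
  obtain q k where qk: "N = q * g" "K = k * g" "coprime q k"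
    using gcd_coprime_exists[of N K] \<open>N > 0\<close> unfolding g_def by auto
  show thesis
  proof (rule that)
    show "0 \<le> k" using \<open>K \<ge> 0\<close> \<open>g > 0\<close> qk by (simp add: zero_le_mult_iff)
    show "(int a + 1) * k \<le> q"
      using NK \<open>g > 0\<close> unfolding qk mult.assoc[symmetric] by simp
    show "0 < q" using \<open>N > 0\<close> \<open>g > 0\<close> unfolding qk by (simp add: zero_less_mult_iff)
    then show "q \<le> int (length w)"
      using \<open>g > 0\<close> mult_left_mono[of 1 g q] unfolding N_def[symmetric] qk by simp
    have "- k \<le> disc q k v \<and> disc q k v \<le> q - k" if "Sublist.prefix v w" for v
    proof -
      have "g * (- k) \<le> g * disc q k v \<and> g * disc q k v \<le> g * (q - k)"
        using conf[OF that] unfolding disc_mult[symmetric] qk by (simp add: algebra_simps)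
      then show ?thesis using \<open>g > 0\<close> by (simp only: mult_le_cancel_left_pos)
    qed
    then show "confined q k 0 w" by (simp add: confined_def)
  qed (use qk in simp)
qed

subsection \<open>Square factorizations\<close>

lemma length_concat_ge:
  assumes "\<And>i. X i \<noteq> []"
  shows "n \<le> length (concat (map X [0..<n]))"
proof (induction n)
  case (Suc n)
  have "length (concat (map X [0..<Suc n])) = length (concat (map X [0..<n])) + length (X n)" by simp
  moreover have "length (X n) \<noteq> 0" using assms by simp
  ultimately show ?case using Suc by linarith
qed simp

lemma map_upt_split: "map X [0..<m + n] = map X [0..<m] @ map (\<lambda>i. X (m + i)) [0..<n]"
  by (induction n) (simp_all add: upt_add_eq_append[OF le0, symmetric])

lemma inf_concat_conc:
  assumes "\<And>i. X i \<noteq> []"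
  shows "inf_concat X = concat (map X [0..<m]) \<frown> inf_concat (\<lambda>i. X (m + i))"
proof
  fix n
  let ?u = "concat (map X [0..<m])" and ?Y = "\<lambda>i. X (m + i)"
  have stable: "concat (map Z [0..<Suc i]) ! i = concat (map Z [0..<Suc i + l]) ! i"
    if "\<And>i. Z i \<noteq> []" for Z :: "nat \<Rightarrow> bit list" and i l
    using length_concat_ge[of Z "Suc i", OF that] unfolding map_upt_split by (simp add: nth_append del: upt_Suc)
  have "inf_concat X n = concat (map X [0..<Suc n + m]) ! n"
    unfolding inf_concat_def by (rule stable[OF assms])
  also have "Suc n + m = m + Suc n" by simp
  also have "concat (map X [0..<m + Suc n]) ! n = (?u @ concat (map ?Y [0..<Suc n])) ! n"
    unfolding map_upt_split by simp
  also have "\<dots> = (?u \<frown> inf_concat ?Y) n"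
  proof (cases "n < length ?u")
    case False
    let ?i = "n - length ?u"
    have "concat (map ?Y [0..<Suc n]) ! ?i = concat (map ?Y [0..<Suc ?i + length ?u]) ! ?i"
      using False by simp
    also have "\<dots> = concat (map ?Y [0..<Suc ?i]) ! ?i"
      by (rule stable[symmetric]) (use assms in simp)
    finally show ?thesis using False by (simp add: nth_append inf_concat_def del: upt_Suc)
  qed (simp add: nth_append)
  finally show "inf_concat X n = (?u \<frown> inf_concat ?Y) n" .
qed

lemma inf_concat_Suc:
  assumes "\<And>i. X i \<noteq> []"
  shows "inf_concat X = X 0 \<frown> inf_concat (\<lambda>i. X (Suc i))"
  using inf_concat_conc[of X 1, OF assms] by simp

text \<open>Here \<open>z i\<close> is what remains once \<open>i\<close> blocks are cut off. After
  \<open>n + 1\<close> nonempty blocks the letter at \<open>n\<close> lies in the part cut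
  off.\<close>

lemma inf_concat_eqI:
  assumes "\<And>i. X i \<noteq> []" and "\<And>i. z i = X i \<frown> z (Suc i)"
  shows "z 0 = inf_concat X"
proof
  fix n
  have "z 0 = concat (map X [0..<m]) \<frown> z m" for m
  proof (induction m)
    case (Suc m)
    then show ?case unfolding assms(2)[of m] by simp
  qed simp
  then have "z 0 n = (concat (map X [0..<Suc n]) \<frown> z (Suc n)) n" by (rule fun_cong)
  then show "z 0 n = inf_concat X n"
    using length_concat_ge[of X "Suc n", OF assms(1)] unfolding inf_concat_def by simp
qed

lemma prefix_inf_concat:
  assumes "\<And>i. X i \<noteq> []" "n \<le> m"
  shows "Sublist.prefix (inf_concat X [0 \<rightarrow> n]) (concat (map X [0..<m]))"
proof -
  have "inf_concat X [0 \<rightarrow> n] = take n (concat (map X [0..<m]))"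
    using length_concat_ge[of X m, OF assms(1)] assms(2)
    by (subst inf_concat_conc[of X m, OF assms(1)]) simp
  then show ?thesis by (simp add: take_is_prefix)
qed

section \<open>Squares of minimal roots as a prefix code\<close>

lemma minimal_roots_not_Nil: "X \<in> minimal_roots a b \<Longrightarrow> X \<noteq> []"
  unfolding minimal_roots_def S1_def S2_def S3_def S4_def S5_def S6_def by auto

lemma length_minimal_roots:
  assumes "1 \<le> a" "X \<in> minimal_roots a b"
  shows "length X \<le> length (S6 a b)"
  using assms unfolding minimal_roots_def S1_def S2_def S3_def S4_def S5_def S6_def by auto

lemma S6_eq: "S6 a b = S5 a b @ S4 a"
  unfolding S4_def S5_def S6_def by (simp flip: replicate_append_same)

lemma square_prefix_code:
  assumes "1 \<le> a" "X \<in> minimal_roots a b" "Y \<in> minimal_roots a b"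
    and "(X @ X) \<frown> x = (Y @ Y) \<frown> y"
  shows "X = Y"
proof -
  obtain a' where a: "a = Suc a'" using assms(1) by (cases a) auto
  \<comment> \<open>A decoder reading the root off a few letters of its square. The second 1 of the
    square of \<open>S2 a\<close> is at \<open>a + 2\<close>, that of \<open>S3 a\<close> one place
    later. After the common prefix \<open>S5 a b\<close> the square of \<open>S5 a b\<close> goes on
    with 10^(a+1), that of \<open>S6 a b\<close> with 10^a 1.\<close>
  define p where "p = (\<lambda>x :: bit word.
    if x 0 = 0 then if x 1 = 0 then [0] else if x (a + 2) = 1 then S2 a else S3 a
    else if x (a + 1) = 1 then S4 a
    else if x (length (S5 a b) + a + 1) = 0 then S5 a b else S6 a b)"
  have "p ((X @ X) \<frown> x) = X" if "X \<in> minimal_roots a b" for X x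
  proof -
    consider "X = S1" | "X = S2 a" | "X = S3 a" | "X = S4 a" | "X = S5 a b" | "X = S6 a b"
      using \<open>X \<in> minimal_roots a b\<close> unfolding minimal_roots_def by blast
    then show ?thesis
    proof cases
      case 1
      then show ?thesis by (simp add: p_def S1_def)
    next
      case 2
      then show ?thesis
        by (simp add: a p_def S2_def nth_append nth_Cons' conc_def)
    next
      case 3
      then show ?thesis
        by (simp add: p_def S3_def nth_append nth_Cons' conc_def)
    next
      case 4
      then show ?thesis
        by (simp add: p_def S4_def nth_append nth_Cons' conc_def)
    next
      case 5
      have "(X @ X) ! 0 = 1" "(X @ X) ! (a + 1) = 0" "(X @ X) ! (length (S5 a b) + a + 1) = 0"
        "length (S5 a b) + a + 1 < length (X @ X)" "0 < length (X @ X)"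
        unfolding 5 by (simp_all add: S5_def nth_append nth_Cons')
      then show ?thesis using 5 by (simp add: p_def conc_def)
    next
      case 6
      have "X @ X = S5 a b @ S4 a @ S5 a b @ S4 a" unfolding 6 S6_eq by simp
      moreover have "S5 a b ! 0 = 1" "S5 a b ! (a + 1) = 0" "length (S5 a b) > a + 1" "S5 a b \<noteq> []"
        by (simp_all add: S5_def nth_append nth_Cons')
      moreover have "(S4 a @ S5 a b @ S4 a) ! (a + 1) = 1"
        by (simp add: S4_def S5_def nth_append nth_Cons')
      ultimately have "(X @ X) ! 0 = 1" "(X @ X) ! (a + 1) = 0"
        "(X @ X) ! (length (S5 a b) + a + 1) = 1"
        "length (S5 a b) + a + 1 < length (X @ X)" "0 < length (X @ X)"
        using nth_append_length_plus[of "S5 a b" "S4 a @ S5 a b @ S4 a" "a + 1"]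
        by (simp_all add: nth_append del: nth_append_length_plus)
      then show ?thesis using 6 by (simp add: p_def conc_def)
    qed
  qed
  from this[OF assms(2), of x] this[OF assms(3), of y] assms(4) show ?thesis by simp
qed

text \<open>Cancelling the blocks before the first disagreement would leave squares of two different
  roots beginning the same word. Together with existence this gives the \<open>THE\<close> in
  \<open>square_root\<close> its meaning.\<close>

lemma square_factorization_unique:
  assumes "1 \<le> a" "square_factorization a b w X" "square_factorization a b w Y"
  shows "X = Y"
proof (rule ccontr)
  assume "X \<noteq> Y"
  then obtain i where "X i \<noteq> Y i" by auto
  define m where "m = (LEAST i. X i \<noteq> Y i)"
  have m: "X m \<noteq> Y m" unfolding m_def by (rule LeastI) fact
  have eq: "X i = Y i" if "i < m" for i using not_less_Least that unfolding m_def by blast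
  have split: "w = concat (map (\<lambda>i. Z i @ Z i) [0..<m]) \<frown> (Z m @ Z m) \<frown>
      inf_concat (\<lambda>i. Z (m + Suc i) @ Z (m + Suc i))"
    and in_roots: "Z m \<in> minimal_roots a b"
    if "square_factorization a b w Z" for Z
  proof -
    have Z: "w = inf_concat (\<lambda>i. Z i @ Z i)" "\<And>i. Z i \<in> minimal_roots a b"
      using that unfolding square_factorization_def by auto
    then have ne: "Z i @ Z i \<noteq> []" for i using minimal_roots_not_Nil by blast
    show "w = concat (map (\<lambda>i. Z i @ Z i) [0..<m]) \<frown> (Z m @ Z m) \<frown>
        inf_concat (\<lambda>i. Z (m + Suc i) @ Z (m + Suc i))"
      unfolding Z(1) using ne inf_concat_conc[of "\<lambda>i. Z i @ Z i" m]
        inf_concat_Suc[of "\<lambda>i. Z (m + i) @ Z (m + i)"] by simp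
    show "Z m \<in> minimal_roots a b" by (rule Z(2))
  qed
  have "map (\<lambda>i. X i @ X i) [0..<m] = map (\<lambda>i. Y i @ Y i) [0..<m]" using eq by simp
  then have "(X m @ X m) \<frown> inf_concat (\<lambda>i. X (m + Suc i) @ X (m + Suc i))
      = (Y m @ Y m) \<frown> inf_concat (\<lambda>i. Y (m + Suc i) @ Y (m + Suc i))"
    using split[OF assms(2)] split[OF assms(3)] by (metis same_concat_eq)
  then show False
    using m square_prefix_code[OF assms(1)] in_roots[OF assms(2)] in_roots[OF assms(3)] by blast
qed

section \<open>Existence of square factorizations\<close>

lemma starts_with_block:
  assumes "\<And>i. X i \<in> {S5 a b, S6 a b}"
  obtains y where "inf_concat X = S5 a b \<frown> S4 a \<frown> y"
proof -
  \<comment> \<open>Both long roots begin with \<open>S4 a\<close>, so a first block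
    \<open>S5 a b\<close> is followed by \<open>S4 a\<close>, while a first block
    \<open>S6 a b\<close> already equals \<open>S5 a b @ S4 a\<close>.\<close>
  have S: "\<exists>z. u = S4 a @ z" if "u \<in> {S5 a b, S6 a b}" for u
    using that unfolding S6_eq by (auto simp: S4_def S5_def simp flip: replicate_append_same)
  have ne: "X i \<noteq> []" for i using assms[of i] by (auto simp: S6_eq S5_def)
  have eq: "inf_concat X = X 0 \<frown> X 1 \<frown> inf_concat (\<lambda>i. X (Suc (Suc i)))"
    using inf_concat_Suc[of X] inf_concat_Suc[of "\<lambda>i. X (Suc i)"] ne by simp
  obtain z where "X 1 = S4 a @ z" using S[OF assms] by blast
  then show ?thesis using that assms[of 0] unfolding eq S6_eq by (auto simp flip: conc_conc)
qed

lemma drop_blocks_cases: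
  obtains l j where "drop t (blocks a n) = replicate l 0 @ blocks a j"
proof -
  have "\<exists>l j. drop t (blocks a n) = replicate l 0 @ blocks a j"
  proof (induction n arbitrary: t)
    case 0
    then show ?case by (auto intro: exI[of _ 0])
  next
    case (Suc n)
    show ?case
    proof (cases t)
      case 0
      then show ?thesis by (metis append_Nil drop0 replicate_0)
    next
      case (Suc t')
      show ?thesis
      proof (cases "t' \<le> a")
        case True
        then have "drop t (blocks a (Suc n)) = replicate (a - t') 0 @ blocks a n"
          using Suc by simp
        then show ?thesis by blast
      next
        case False
        then have "drop t (blocks a (Suc n)) = drop (t' - a) (blocks a n)"
          using Suc by simp
        then show ?thesis using Suc.IH by simp
      qed
    qed
  qed
  then show thesis using that by blast
qed

text \<open>Only the uncut root has a 1 followed by a + 1 zeros. Once that 1 is gone, a cut leaves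
  some zeros and then whole blocks 10^a.\<close>

lemma drop_long_root_cases:
  assumes "0 < t"
  obtains l j where "drop t (1 # replicate (a + 1) 0 @ blocks a n) = replicate l 0 @ blocks a j"
proof -
  obtain t' where t: "t = Suc t'" using assms by (cases t) auto
  obtain l j where "drop (t' - (a + 1)) (blocks a n) = replicate l 0 @ blocks a j"
    by (rule drop_blocks_cases)
  then have "drop t (1 # replicate (a + 1) 0 @ blocks a n)
      = replicate ((a + 1 - t') + l) 0 @ blocks a j"
    unfolding t by (simp add: replicate_add del: replicate_Suc)
  then show thesis by (rule that)
qed

lemma inf_concat_locate:
  assumes "\<And>i. X i \<noteq> []"
  obtains m t where "t < length (X m)"
    "Omega_Words_Fun.suffix i (inf_concat X) = drop t (X m) \<frown> inf_concat (\<lambda>i. X (Suc m + i))"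
proof -
  let ?P = "\<lambda>m. length (concat (map X [0..<m]))"
  have P_ge: "n \<le> ?P n" for n by (rule length_concat_ge[of X, OF assms])
  have "?P 0 \<le> i \<and> i < ?P (Suc i)" using P_ge[of "Suc i"] by (simp del: upt_Suc)
  then obtain m where m: "?P m \<le> i" "i < ?P (Suc m)"
    using ex_least_nat_less[of "\<lambda>n. i < ?P n" "Suc i"] by (metis le_simps(1) lessI not_less)
  define t where "t = i - ?P m"
  have t: "t < length (X m)" "i = ?P m + t" using m by (simp_all add: t_def)
  have "inf_concat X = concat (map X [0..<m]) \<frown> X m \<frown> inf_concat (\<lambda>i. X (Suc m + i))"
    using inf_concat_conc[of X "Suc m", OF assms] by simp
  then have "Omega_Words_Fun.suffix i (inf_concat X)
      = Omega_Words_Fun.suffix t (X m \<frown> inf_concat (\<lambda>i. X (Suc m + i)))"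
    using suffix_conc_snd[of "concat (map X [0..<m])" i] t(2)
    by (simp del: conc_conc suffix_conc_snd)
  then show thesis using that t(1) by simp
qed

text \<open>The rest of the current block decides. If it is the whole block, the following
  \<open>S5 a b\<close> and \<open>S4 a\<close> complete the square of \<open>S5 a b\<close> or
  \<open>S6 a b\<close>. Otherwise it is 0^l (10^a)^j, and the root is \<open>S1\<close> for l >= 2,
  \<open>S3 a\<close> for l = 1 and j = 0, \<open>S2 a\<close> for l = 1 and j > 0, and
  \<open>S4 a\<close> for l = 0.\<close>

lemma block_word_starts_with_square:
  assumes "1 \<le> a" "\<And>i. X i \<in> {S5 a b, S6 a b}"
  shows "\<exists>Y\<in>minimal_roots a b. \<exists>z. Omega_Words_Fun.suffix i (inf_concat X) = (Y @ Y) \<frown> z"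
proof -
  have ne: "X i \<noteq> []" for i using assms(2)[of i] by (auto simp: S6_eq S5_def)
  obtain m t where t: "t < length (X m)"
    and eq: "Omega_Words_Fun.suffix i (inf_concat X)
      = drop t (X m) \<frown> inf_concat (\<lambda>i. X (Suc m + i))"
    using inf_concat_locate[of X i, OF ne] by metis
  obtain y where y: "inf_concat (\<lambda>i. X (Suc m + i)) = S5 a b \<frown> S4 a \<frown> y"
    using starts_with_block[of "\<lambda>i. X (Suc m + i)" a b] assms(2) by blast
  define w where "w = drop t (X m) \<frown> S5 a b \<frown> S4 a \<frown> y"
  obtain a' where a: "a = Suc a'" using assms(1) by (cases a) auto
  have Z: "\<exists>y'. blocks a j \<frown> S5 a b \<frown> S4 a \<frown> y = S4 a \<frown> y'" for j
  proof (cases j)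
    case 0
    have "S5 a b = S4 a @ [0] @ blocks a b"
      unfolding S4_def S5_def by (simp flip: replicate_append_same)
    then show ?thesis using 0 by (simp del: build_cons build_append) (metis append.assoc conc_conc)
  next
    case (Suc j')
    then have "blocks a j \<frown> S5 a b \<frown> S4 a \<frown> y = S4 a \<frown> blocks a j' \<frown> S5 a b \<frown> S4 a \<frown> y"
      by (simp add: S4_def)
    then show ?thesis by blast
  qed
  have "\<exists>Y\<in>minimal_roots a b. \<exists>z. w = (Y @ Y) \<frown> z"
  proof (cases "t = 0")
    case True
    show ?thesis
    proof (cases "X m = S5 a b")
      case True
      then have "w = (S5 a b @ S5 a b) \<frown> S4 a \<frown> y" using \<open>t = 0\<close> by (simp add: w_def)
      then show ?thesis unfolding minimal_roots_def by blast
    next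
      case False
      then have "w = (S6 a b @ S6 a b) \<frown> y" using \<open>t = 0\<close> assms(2)[of m] by (simp add: w_def S6_eq)
      then show ?thesis unfolding minimal_roots_def by blast
    qed
  next
    case False
    have "X m = 1 # replicate (a + 1) 0 @ blocks a b \<or> X m = 1 # replicate (a + 1) 0 @ blocks a (b + 1)"
      using assms(2)[of m] unfolding S5_def S6_def by auto
    then obtain n where "X m = 1 # replicate (a + 1) 0 @ blocks a n" by blast
    then obtain l j where lj: "drop t (X m) = replicate l 0 @ blocks a j"
      using drop_long_root_cases[of t a n] False by auto
    then have w: "w = replicate l 0 \<frown> blocks a j \<frown> S5 a b \<frown> S4 a \<frown> y" by (simp add: w_def)
    have lj0: "l > 0 \<or> j > 0" using lj t by (cases l; cases j) auto
    obtain y' where y': "blocks a j \<frown> S5 a b \<frown> S4 a \<frown> y = S4 a \<frown> y'" using Z by blast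
    consider "2 \<le> l" | "l = 1" "j = 0" | j' where "l = 1" "j = Suc j'" | j' where "l = 0" "j = Suc j'"
      using lj0 by (cases j) force+
    then show ?thesis
    proof cases
      case 1
      then obtain l' where "l = Suc (Suc l')" by (metis Suc_le_D numeral_2_eq_2 Suc_le_mono)
      then have "w = (S1 @ S1) \<frown> replicate l' 0 \<frown> S4 a \<frown> y'"
        unfolding w y' by (simp add: S1_def)
      then show ?thesis unfolding minimal_roots_def by blast
    next
      case 2
      \<comment> \<open>The blocks are followed by \<open>S4 a\<close>, so a 10^a begins here even
        for \<open>b = 0\<close>.\<close>
      obtain y'' where y'': "blocks a b \<frown> S4 a \<frown> y = S4 a \<frown> y''"
      proof (cases b)
        case 0
        then show ?thesis using that by simp
      next
        case (Suc b')
        then show ?thesis using that[of "blocks a b' \<frown> S4 a \<frown> y"] by (simp add: S4_def)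
      qed
      have "w = [0, 1] \<frown> replicate (a + 1) 0 \<frown> blocks a b \<frown> S4 a \<frown> y"
        unfolding w by (simp add: 2 S5_def)
      also have "\<dots> = (S3 a @ S3 a) \<frown> y''"
        unfolding y'' by (simp add: S3_def S4_def flip: replicate_append_same)
      finally show ?thesis unfolding minimal_roots_def by blast
    next
      case 3
      obtain v where v: "blocks a j' \<frown> S5 a b \<frown> S4 a \<frown> y = S4 a \<frown> v" using Z by blast
      have "w = [0] \<frown> S4 a \<frown> blocks a j' \<frown> S5 a b \<frown> S4 a \<frown> y"
        unfolding w by (simp add: 3 S4_def)
      \<comment> \<open>The word 0 10^a 10^a is 010^(a-1) 010^(a-1) 0, so one 0 is left
        over.\<close>
      also have "\<dots> = (S2 a @ S2 a) \<frown> [0] \<frown> v"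
        unfolding v by (simp add: a S2_def S4_def flip: replicate_append_same)
      finally show ?thesis unfolding minimal_roots_def by blast
    next
      case 4
      obtain v where v: "blocks a j' \<frown> S5 a b \<frown> S4 a \<frown> y = S4 a \<frown> v" using Z by blast
      have "w = S4 a \<frown> blocks a j' \<frown> S5 a b \<frown> S4 a \<frown> y"
        unfolding w by (simp add: 4 S4_def)
      also have "\<dots> = (S4 a @ S4 a) \<frown> v"
        unfolding v by simp
      finally show ?thesis unfolding minimal_roots_def by blast
    qed
  qed
  then show ?thesis using eq y w_def by simp
qed

lemma Lang_starts_with_square:
  assumes "1 \<le> a" "factors z \<subseteq> Lang a b"
  shows "\<exists>Y\<in>minimal_roots a b. \<exists>z'. z = (Y @ Y) \<frown> z'"
proof -
  \<comment> \<open>\<open>S6 a b\<close> is the longest root, so a window of this length contains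
    the square of any root that begins it.\<close>
  let ?l = "2 * length (S6 a b)"
  have "z [0 \<rightarrow> ?l] \<in> Lang a b" using assms(2) unfolding factors_def by blast
  then obtain X i j where X: "range X \<subseteq> {S5 a b, S6 a b}"
    and eq: "z [0 \<rightarrow> ?l] = inf_concat X [i \<rightarrow> j]"
    unfolding Lang_def factors_def by blast
  obtain Y z' where Y: "Y \<in> minimal_roots a b"
    and z': "Omega_Words_Fun.suffix i (inf_concat X) = (Y @ Y) \<frown> z'"
    using block_word_starts_with_square[OF assms(1), of X b i] X by blast
  let ?n = "length (Y @ Y)"
  have n: "?n \<le> ?l" using length_minimal_roots[OF assms(1) Y] by simp
  have "?l = j - i" using arg_cong[OF eq, of length] by simp
  then have l: "z [0 \<rightarrow> ?l] = ((Y @ Y) \<frown> z') [0 \<rightarrow> ?l]"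
    unfolding eq z'[symmetric] by (simp only: subsequence_prefix_suffix)
  have "z [0 \<rightarrow> ?n] = take ?n (z [0 \<rightarrow> ?l])" using n by (simp add: min_def)
  also have "\<dots> = take ?n (((Y @ Y) \<frown> z') [0 \<rightarrow> ?l])" unfolding l ..
  also have "\<dots> = ((Y @ Y) \<frown> z') [0 \<rightarrow> ?n]"
    using n by (simp only: subsequence_take add_0 min.absorb1)
  also have "\<dots> = Y @ Y" by (rule prefix_conc_length)
  finally have "z [0 \<rightarrow> ?n] = Y @ Y" .
  then have "z = (Y @ Y) \<frown> Omega_Words_Fun.suffix (length (Y @ Y)) z"
    using prefix_suffix[of z "length (Y @ Y)"] by simp
  then show ?thesis using Y by blast
qed

lemma factors_suffix: "factors (Omega_Words_Fun.suffix n w) \<subseteq> factors w"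
  unfolding factors_def by auto

text \<open>Squares are peeled off one by one: the remainder is a suffix, so its factors stay in
  \<open>Lang a b\<close> and a further square begins it.\<close>

lemma square_factorization_exists:
  assumes "1 \<le> a" "factors w \<subseteq> Lang a b"
  obtains X where "square_factorization a b w X"
proof -
  define root where "root = (\<lambda>z. SOME Y. Y \<in> minimal_roots a b \<and> (\<exists>z'. z = (Y @ Y) \<frown> z'))"
  define rest where "rest = (\<lambda>z. Omega_Words_Fun.suffix (length (root z @ root z)) z)"
  define z where "z = (\<lambda>i. (rest ^^ i) w)"
  have step: "root u \<in> minimal_roots a b \<and> u = (root u @ root u) \<frown> rest u"
    if u: "factors u \<subseteq> Lang a b" for u
  proof -
    have "\<exists>Y. Y \<in> minimal_roots a b \<and> (\<exists>z'. u = (Y @ Y) \<frown> z')"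
      using Lang_starts_with_square[OF assms(1) u] by blast
    then have "root u \<in> minimal_roots a b \<and> (\<exists>z'. u = (root u @ root u) \<frown> z')"
      unfolding root_def by (rule someI_ex)
    then show ?thesis unfolding rest_def by (metis suffix_conc_length)
  qed
  have fz: "factors (z i) \<subseteq> Lang a b" for i
  proof (induction i)
    case (Suc i)
    have "z (Suc i) = rest (z i)" by (simp add: z_def)
    then show ?case using subset_trans[OF factors_suffix Suc] unfolding rest_def by (simp only:)
  qed (use assms(2) in \<open>simp add: z_def\<close>)
  have "z 0 = inf_concat (\<lambda>i. root (z i) @ root (z i))"
  proof (rule inf_concat_eqI)
    fix i
    show "root (z i) @ root (z i) \<noteq> []" using step[OF fz] minimal_roots_not_Nil by blast
    show "z i = (root (z i) @ root (z i)) \<frown> z (Suc i)" using step[OF fz[of i]] by (simp add: z_def)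
  qed
  then have "square_factorization a b w (\<lambda>i. root (z i))"
    unfolding square_factorization_def using step[OF fz] by (auto simp: z_def)
  then show thesis by (rule that)
qed

lemma square_root_eq:
  assumes "1 \<le> a" "factors w \<subseteq> Lang a b"
  obtains X where "range X \<subseteq> minimal_roots a b" "w = inf_concat (\<lambda>i. X i @ X i)"
    "square_root a b w = inf_concat X"
proof -
  obtain X where X: "square_factorization a b w X"
    using square_factorization_exists[OF assms] .
  then have "(THE X. square_factorization a b w X) = X"
    using square_factorization_unique[OF assms(1)] by blast
  then show thesis using that X unfolding square_root_def square_factorization_def by auto
qed

subsection \<open>Recurrence and balance\<close>

lemma mem_factors_iff: "u \<in> factors w \<longleftrightarrow> (\<exists>i. u = w [i \<rightarrow> i + length u])"
proof
  assume "u \<in> factors w"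
  then obtain i j where u: "u = w [i \<rightarrow> j]" unfolding factors_def by blast
  have "w [i \<rightarrow> j] = w [i \<rightarrow> i + (j - i)]" by (cases "i \<le> j") simp_all
  then show "\<exists>i. u = w [i \<rightarrow> i + length u]" unfolding u by (intro exI[of _ i]) simp
qed (auto simp: factors_def)

lemma factors_sublist:
  assumes "u \<in> factors w" "sublist v u"
  shows "v \<in> factors w"
proof -
  obtain i j where u: "u = w [i \<rightarrow> j]" using assms(1) unfolding factors_def by blast
  obtain y z where "u = y @ v @ z" using assms(2) unfolding sublist_def by blast
  then have "v = take (length v) (drop (length y) u)" by simp
  then have "v = w [i + length y \<rightarrow> min (i + length y + length v) j]" unfolding u by simp
  then show ?thesis unfolding factors_def by blast
qed

lemma finite_length_bit: "finite {u :: bit list. length u = n}"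
proof -
  have "finite (UNIV :: bit set)"
  proof (rule finite_subset)
    show "(UNIV :: bit set) \<subseteq> {0, 1}" by (metis bit_not_one_iff insertCI subsetI)
  qed simp
  from finite_lists_length_eq[OF this, of n] show ?thesis by simp
qed

text \<open>Koenig's lemma: a word with arbitrarily long prolongations in \<open>T\<close> keeps
  this property under one of the two letters, so an infinite word can be grown letter by
  letter.\<close>

lemma konig:
  assumes closed: "\<And>u v. u \<in> T \<Longrightarrow> sublist v u \<Longrightarrow> v \<in> T"
    and unbounded: "\<And>n. \<exists>u\<in>T. n \<le> length u"
  obtains w :: "bit word" where "factors w \<subseteq> T"
proof -
  define E where "E u \<longleftrightarrow> (\<forall>n. \<exists>v\<in>T. n \<le> length v \<and> Sublist.prefix u v)" for u :: "bit list"
  have ext: "\<exists>c. E (u @ [c])" if "E u" for u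
  proof (rule ccontr)
    assume "\<nexists>c. E (u @ [c])"
    then have "\<not> E (u @ [0])" "\<not> E (u @ [1])" by blast+
    then obtain m n where mn: "\<And>v. v \<in> T \<Longrightarrow> m \<le> length v \<Longrightarrow> \<not> Sublist.prefix (u @ [0]) v"
      "\<And>v. v \<in> T \<Longrightarrow> n \<le> length v \<Longrightarrow> \<not> Sublist.prefix (u @ [1]) v"
      unfolding E_def by blast
    \<comment> \<open>This length exceeds both bounds \<open>m\<close> and \<open>n\<close> and
      leaves at least one letter after \<open>u\<close>.\<close>
    obtain v where v: "v \<in> T" "length u + m + n + 1 \<le> length v" "Sublist.prefix u v"
      using \<open>E u\<close> unfolding E_def by blast
    then obtain z where "v = u @ z" unfolding prefix_def by blast
    moreover then obtain c z' where "z = c # z'" using v(2) by (cases z) auto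
    ultimately have "Sublist.prefix (u @ [c]) v" by simp
    then show False using mn[of v] v by (cases c) auto
  qed
  define c where "c u = (SOME c. E (u @ [c]))" for u
  have Ec: "E (u @ [c u])" if "E u" for u using someI_ex[OF ext[OF that]] unfolding c_def .
  define s where "s n = ((\<lambda>u. u @ [c u]) ^^ n) []" for n
  have Es: "E (s n)" for n
    by (induction n) (use unbounded Ec in \<open>auto simp: s_def E_def\<close>)
  define w where "w n = c (s n)" for n
  have ws: "w [0 \<rightarrow> n] = s n" for n
    by (induction n) (simp_all add: s_def w_def)
  have "u \<in> T" if u: "u \<in> factors w" for u
  proof -
    obtain i where "u = w [i \<rightarrow> i + length u]" using u unfolding mem_factors_iff by blast
    then have "w [0 \<rightarrow> i + length u] = w [0 \<rightarrow> i] @ u" using subsequence_append by metis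
    then have "sublist u (w [0 \<rightarrow> i + length u])" by simp
    moreover have "\<exists>v\<in>T. Sublist.prefix (s (i + length u)) v" using Es unfolding E_def by blast
    ultimately show "u \<in> T" unfolding ws
      using closed prefix_imp_sublist sublist_order.order_trans by blast
  qed
  then show thesis using that by blast
qed

text \<open>Uniform recurrence. If arbitrarily long words of the language avoided \<open>v\<close>,
  compactness would give an infinite word avoiding \<open>v\<close>, and the words of \<Omega>
  avoiding \<open>v\<close> would form a nonempty proper subshift.\<close>

lemma minimal_subshift_recurrent:
  assumes "minimal_subshift \<Omega>" "v \<in> language \<Omega>"
  obtains R where "\<And>u. u \<in> language \<Omega> \<Longrightarrow> R \<le> length u \<Longrightarrow> sublist v u"
proof (rule ccontr)
  assume "\<not> thesis"
  then have avoid: "\<exists>u\<in>language \<Omega>. R \<le> length u \<and> \<not> sublist v u" for R using that by blast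
  obtain L where L: "\<Omega> = {w. factors w \<subseteq> L}"
    using assms(1) unfolding minimal_subshift_def subshift_def by blast
  define T where "T = {u \<in> language \<Omega>. \<not> sublist v u}"
  obtain w where w: "factors w \<subseteq> T"
  proof (rule konig)
    show "u' \<in> T" if "u \<in> T" "sublist u' u" for u u'
      using that factors_sublist sublist_order.order_trans unfolding T_def language_def by blast
    show "\<exists>u\<in>T. n \<le> length u" for n using avoid unfolding T_def by blast
  qed
  define \<Omega>' where "\<Omega>' = {w \<in> \<Omega>. v \<notin> factors w}"
  have "subshift \<Omega>'"
    unfolding subshift_def
  proof (intro exI conjI)
    \<comment> \<open>The language of \<open>\<Omega>'\<close> defines this subshift: as a set of
      factors of infinite words it is extendable, which is not evident for \<open>T\<close>.\<close>
    show "extendable (language \<Omega>')"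
      unfolding extendable_def language_def
    proof
      fix u assume "u \<in> (\<Union>w\<in>\<Omega>'. factors w)"
      then obtain w where "w \<in> \<Omega>'" "u \<in> factors w" by blast
      moreover from this(2) obtain i where "u = w [i \<rightarrow> i + length u]"
        unfolding mem_factors_iff by blast
      ultimately have "w \<in> \<Omega>'" "u @ [w (i + length u)] = w [i \<rightarrow> Suc (i + length u)]" by simp_all
      then show "\<exists>x. u @ [x] \<in> (\<Union>w\<in>\<Omega>'. factors w)" unfolding factors_def by blast
    qed
    show "factor_closed (language \<Omega>')"
      unfolding factor_closed_def language_def using factors_sublist by blast
    have "language \<Omega>' \<subseteq> L" "v \<notin> language \<Omega>'" unfolding \<Omega>'_def language_def L by auto
    then show "\<Omega>' = {w. factors w \<subseteq> language \<Omega>'}"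
      unfolding \<Omega>'_def L language_def by blast
  qed
  moreover have "w \<in> \<Omega>'"
    using w unfolding \<Omega>'_def L T_def language_def by auto
  moreover have "\<Omega>' \<subset> \<Omega>" using assms(2) unfolding \<Omega>'_def language_def by blast
  ultimately show False using assms(1) unfolding minimal_subshift_def by blast
qed

lemma subshift_suffix:
  assumes "subshift \<Omega>" "w \<in> \<Omega>"
  shows "Omega_Words_Fun.suffix n w \<in> \<Omega>"
  using assms factors_suffix[of n w] unfolding subshift_def by blast

section \<open>Balanced aperiodic words\<close>

lemma right_special_exists:
  assumes "\<not> ultimately_periodic w"
  shows "\<exists>u. length u = n \<and> u @ [0] \<in> factors w \<and> u @ [1] \<in> factors w"
proof (rule ccontr)
  assume none: "\<not> ?thesis"
  \<comment> \<open>The Morse-Hedlund argument: every window of length \<open>n\<close> now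
    determines the next letter, so a window occurring twice makes the word ultimately
    periodic.\<close>
  have unique: "c = d" if "u @ [c] \<in> factors w" "u @ [d] \<in> factors w" "length u = n" for u c d
    using that none by (cases c; cases d) blast+
  have "\<not> inj (\<lambda>i. w [i \<rightarrow> i + n])"
  proof
    assume "inj (\<lambda>i. w [i \<rightarrow> i + n])"
    moreover have "finite (range (\<lambda>i. w [i \<rightarrow> i + n]))"
      by (rule finite_subset[OF _ finite_length_bit[of n]]) auto
    ultimately have "finite (UNIV :: nat set)" by (rule finite_imageD[rotated])
    then show False by simp
  qed
  then obtain i j where "i \<noteq> j" "w [i \<rightarrow> i + n] = w [j \<rightarrow> j + n]" unfolding inj_def by blast
  then obtain i j where ij: "i < j" "w [i \<rightarrow> i + n] = w [j \<rightarrow> j + n]"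
    by (metis nat_neq_iff)
  have eq: "w (i + m) = w (j + m)" for m
  proof (induction m rule: less_induct)
    case (less m)
    show ?case
    proof (cases "m < n")
      case True
      then show ?thesis using arg_cong[OF ij(2), of "\<lambda>u. u ! m"] by simp
    next
      case False
      then obtain l where l: "m = l + n" by (metis add.commute le_Suc_ex not_less)
      have window: "w [i + l \<rightarrow> i + m] = w [j + l \<rightarrow> j + m]"
      proof (rule nth_equalityI)
        fix t assume "t < length (w [i + l \<rightarrow> i + m])"
        then have "t < n" using l by simp
        then have "w (i + (l + t)) = w (j + (l + t))" using less l by simp
        then show "w [i + l \<rightarrow> i + m] ! t = w [j + l \<rightarrow> j + m] ! t"
          using \<open>t < n\<close> l by (simp add: add.assoc)
      qed simp
      have "w [p + l \<rightarrow> p + m] @ [w (p + m)] \<in> factors w" for p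
        using subseq_to_Suc[of "p + l" "p + m" w] l unfolding factors_def by (metis (mono_tags, lifting) add_left_mono le_add1 mem_Collect_eq)
      from this[of i] this[of j] show ?thesis
        unfolding window by (rule unique) (simp add: l)
    qed
  qed
  have "w (l + (j - i)) = w l" if "i \<le> l" for l
    using eq[of "l - i"] that ij(1) by (simp add: add.commute)
  then have "\<exists>N. \<forall>l\<ge>N. w (l + (j - i)) = w l" by blast
  then have "ultimately_periodic w"
    unfolding ultimately_periodic_def using ij(1) zero_less_diff by blast
  then show False using assms by blast
qed

text \<open>Excluding pairs 0z0, 1z1 is the usual local form of balance. Two different right special
  words of equal length have a longest common suffix z preceded by different letters; since both
  prolong by 0 and by 1, such a pair arises.\<close>

lemma right_special_unique:
  assumes balanced: "\<And>z. \<not> (0 # z @ [0] \<in> factors w \<and> 1 # z @ [1] \<in> factors w)"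
    and u: "\<And>c. u @ [c] \<in> factors w" and v: "\<And>c. v @ [c] \<in> factors w" and len: "length u = length v"
  shows "u = v"
proof (rule ccontr)
  assume "u \<noteq> v"
  then have "rev u \<parallel> rev v" using len by (intro not_equal_is_parallel) auto
  then obtain z c d x y where cd: "c \<noteq> d" and "rev u = z @ c # x" "rev v = z @ d # y"
    using parallel_decomp by blast
  then have uv: "u = rev x @ c # rev z" "v = rev y @ d # rev z"
    by (metis append.assoc append_Cons append_Nil rev.simps(2) rev_append rev_rev_ident)+
  have "c # rev z @ [e] \<in> factors w" "d # rev z @ [e] \<in> factors w" for e
    using factors_sublist[OF u[of e], of "c # rev z @ [e]"]
      factors_sublist[OF v[of e], of "d # rev z @ [e]"] unfolding uv
    by (simp_all add: sublist_append_rightI)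
  then show False using balanced[of "rev z"] cd by (cases c; cases d) auto
qed

text \<open>Every factor prolongs to the right, and exactly one factor \<open>r\<close> of each
  length does so in two ways. Discarding \<open>r @ [1]\<close> makes \<open>butlast\<close> a
  bijection, so the number of factors grows by one.\<close>

lemma sturmianI:
  assumes "\<not> ultimately_periodic w"
    and balanced: "\<And>z. \<not> (0 # z @ [0] \<in> factors w \<and> 1 # z @ [1] \<in> factors w)"
  shows "sturmian w"
  unfolding sturmian_def
proof
  fix n
  define F where "F n = {u \<in> factors w. length u = n}" for n
  have fin: "finite (F n)" for n
    unfolding F_def by (rule finite_subset[OF _ finite_length_bit[of n]]) auto
  have "card (F n) = n + 1"
  proof (induction n)
    case 0
    have "F 0 = {[]}" unfolding F_def mem_factors_iff by auto
    then show ?case by simp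
  next
    case (Suc n)
    obtain r where r: "length r = n" "r @ [0] \<in> factors w" "r @ [1] \<in> factors w"
      using right_special_exists[OF assms(1)] by blast
    have r': "r @ [c] \<in> factors w" for c using r by (cases c) auto
    have prolong: "\<exists>c. u @ [c] \<in> factors w" if u: "u \<in> factors w" for u
    proof -
      obtain i where "u = w [i \<rightarrow> i + length u]" using u unfolding mem_factors_iff by blast
      then have "u @ [w (i + length u)] = w [i \<rightarrow> Suc (i + length u)]" by simp
      then show ?thesis unfolding factors_def by blast
    qed
    have "bij_betw butlast (F (Suc n) - {r @ [1]}) (F n)"
      unfolding bij_betw_def
    proof
      show "inj_on butlast (F (Suc n) - {r @ [1]})"
      proof (rule inj_onI, rule ccontr)
        fix x y assume x: "x \<in> F (Suc n) - {r @ [1]}" and y: "y \<in> F (Suc n) - {r @ [1]}"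
          and eq: "butlast x = butlast y" and "x \<noteq> y"
        define u where "u = butlast x"
        have ne: "x \<noteq> []" "y \<noteq> []" using x y unfolding F_def by auto
        then have xy: "x = u @ [last x]" "y = u @ [last y]" unfolding u_def by (simp, simp add: eq)
        then have "last x \<noteq> last y" using \<open>x \<noteq> y\<close> by auto
        then have "c = last x \<or> c = last y" for c by (cases c; cases "last x"; cases "last y") auto
        then have "u @ [c] = x \<or> u @ [c] = y" for c using xy by metis
        then have "u @ [c] \<in> factors w" for c using x y unfolding F_def by (metis (lifting) DiffD1 mem_Collect_eq)
        moreover have "length u = length r" using x r unfolding u_def F_def by simp
        ultimately have "u = r" using right_special_unique[of w u r, OF balanced] r' by blast
        then show False using x y xy \<open>last x \<noteq> last y\<close> by (cases "last x"; cases "last y") auto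
      qed
      show "butlast ` (F (Suc n) - {r @ [1]}) = F n"
      proof (intro equalityI subsetI)
        fix u assume "u \<in> butlast ` (F (Suc n) - {r @ [1]})"
        then obtain x where x: "x \<in> F (Suc n)" "u = butlast x" by blast
        have "butlast x \<in> factors w"
          using x factors_sublist[of x w] prefixeq_butlast prefix_imp_sublist unfolding F_def by blast
        then show "u \<in> F n" using x unfolding F_def by simp
      next
        fix u assume u: "u \<in> F n"
        \<comment> \<open>For \<open>u = r\<close> the letter must be 0, as \<open>r @ [1]\<close>
          has been discarded.\<close>
        obtain c where "u @ [c] \<in> factors w" "u = r \<Longrightarrow> c = 0"
          using prolong[of u] r' u unfolding F_def by blast
        then have "u @ [c] \<in> F (Suc n) - {r @ [1]}" using u unfolding F_def by auto
        then show "u \<in> butlast ` (F (Suc n) - {r @ [1]})" by (metis butlast_snoc image_eqI)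
      qed
    qed
    then have "card (F (Suc n) - {r @ [1]}) = card (F n)" by (rule bij_betw_same_card)
    moreover have "r @ [1] \<in> F (Suc n)" using r unfolding F_def by simp
    ultimately have "card (F (Suc n)) = Suc (card (F n))"
      using fin[of "Suc n"] by (metis card_Suc_Diff1)
    then show ?case using Suc by simp
  qed
  then show "card {u \<in> factors w. length u = n} = n + 1" unfolding F_def .
qed

subsection \<open>Words of confined discrepancy\<close>

text \<open>The interval has length \<open>q\<close>, so 0z0 lowers the discrepancy by at most
  \<open>q\<close> and 1z1 raises it by at most \<open>q\<close>. These changes differ by exactly
  \<open>2 * q\<close>, so both bounds are attained and
  \<open>disc q k z = 2 * k - q\<close>.\<close>

lemma confined_balanced:
  assumes "coprime q k" "confined q k s w" "sublist (0 # z @ [0]) w" "sublist (1 # z @ [1]) w"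
  shows "q \<le> int (length z + 2)"
proof -
  have confinedD: "s \<in> {- k..q - k}" "s + disc q k u \<in> {- k..q - k}" if "confined q k s u" for s u
    using that[unfolded confined_def, rule_format, of "[]"]
      that[unfolded confined_def, rule_format, of u] by simp_all
  obtain s\<^sub>0 s\<^sub>1 where "confined q k s\<^sub>0 (0 # z @ [0])" "confined q k s\<^sub>1 (1 # z @ [1])"
    using confined_sublist[OF assms(2)] assms(3,4) by metis
  from this[THEN confinedD(1)] this[THEN confinedD(2)]
  have "q + disc q k z - 2 * k + q = q" by simp
  then have "k * int (length z + 2) = q * (int (count_list z 1) + 1)"
    by (simp add: disc_def algebra_simps)
  then have "q dvd k * int (length z + 2)" by simp
  then have "q dvd int (length z + 2)" using assms(1) by (simp add: coprime_dvd_mult_right_iff)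
  then show ?thesis by (rule zdvd_imp_le) simp
qed

lemma confined_odd_root_periodic:
  assumes "1 \<le> a" "0 \<le> k" "(int a + 1) * k \<le> q" "range X \<subseteq> minimal_roots a b"
    and conf: "\<And>n. confined q k s (inf_concat (\<lambda>i. X i @ X i) [0 \<rightarrow> n])" and "odd s"
  shows "ultimately_periodic (inf_concat X)"
proof -
  define r where "r = inf_concat X"
  \<comment> \<open>Twice the discrepancy along the root, which starts at half of the odd number
    \<open>s\<close>.\<close>
  define F where "F j = s + 2 * disc q k (r [0 \<rightarrow> j])" for j
  have ne: "X i \<noteq> []" for i using assms(4) minimal_roots_not_Nil by blast
  have bounds: "- 2 * k < F j \<and> F j < 2 * (q - k)" for j
  proof -
    define Xs where "Xs = map X [0..<j]"
    have roots: "set Xs \<subseteq> minimal_roots a b" using assms(4) unfolding Xs_def by auto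
    have "square_product Xs = concat (map (\<lambda>i. X i @ X i) [0..<j])"
      unfolding square_product_def Xs_def map_map by (simp add: comp_def)
    then have sq: "inf_concat (\<lambda>i. X i @ X i) [0 \<rightarrow> length (square_product Xs)] = square_product Xs"
      using inf_concat_conc[of "\<lambda>i. X i @ X i" j] ne by simp
    have sqb: "- k \<le> s + disc q k u \<and> s + disc q k u \<le> q - k"
      if "Sublist.prefix u (square_product Xs)" for u
      using conf[of "length (square_product Xs)", unfolded sq confined_def] that by simp
    have pre: "Sublist.prefix (r [0 \<rightarrow> j]) (concat Xs)"
      unfolding r_def Xs_def by (rule prefix_inf_concat[of X j j, OF ne]) simp
    \<comment> \<open>With \<open>M = q - k\<close> both alternatives of
      \<open>disc_root_upper\<close> give the same bound, and likewise below with
      \<open>m = - k\<close>. Parity then makes both strict.\<close>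
    have "F j \<le> 2 * (q - k)"
      using disc_root_upper[OF assms(1-3) roots _ pre, of s "q - k"] sqb unfolding F_def by auto
    moreover have "- 2 * k \<le> F j"
      using disc_root_lower[OF assms(1-3) roots _ pre, of "- k" s] sqb unfolding F_def by auto
    moreover have "odd (F j)" unfolding F_def using \<open>odd s\<close> by simp
    then have "F j \<noteq> 2 * (q - k)" "F j \<noteq> - 2 * k" by auto
    ultimately show ?thesis by linarith
  qed
  have FSuc: "F (Suc j) = F j + (if r j = 1 then 2 * (q - k) else - 2 * k)" for j
    unfolding F_def by (cases "r j") simp_all
  \<comment> \<open>A 0 keeps \<open>F\<close> above \<open>- 2 * k\<close> only if
    \<open>F j > 0\<close>, a 1 keeps it below \<open>2 * (q - k)\<close> only if
    \<open>F j < 0\<close>. So \<open>F\<close> follows a deterministic rule on finitely many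
    values.\<close>
  have letter: "r j = 1 \<longleftrightarrow> F j < 0" for j
    using bounds[of "Suc j"] FSuc[of j] by (cases "r j") auto
  have "\<not> inj F"
  proof
    assume "inj F"
    moreover have "F j \<in> {- 2 * k..2 * (q - k)}" for j using bounds[of j] by simp
    then have "finite (range F)"
      by (intro finite_subset[OF _ finite_atLeastAtMost_int[of "- 2 * k" "2 * (q - k)"]]) blast
    ultimately have "finite (UNIV :: nat set)" by (rule finite_imageD[rotated])
    then show False by simp
  qed
  then obtain i j where "i \<noteq> j" "F i = F j" unfolding inj_def by blast
  then obtain i j where ij: "i < j" "F i = F j" by (metis nat_neq_iff)
  have eq: "F (i + m) = F (j + m)" for m
    by (induction m) (simp_all add: ij FSuc letter)
  have "r (l + (j - i)) = r l" if "i \<le> l" for l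
  proof -
    obtain m where l: "l = i + m" using \<open>i \<le> l\<close> le_Suc_ex by blast
    then have "l + (j - i) = j + m" using ij(1) by simp
    moreover have "r (j + m) = r l"
      using letter[of "j + m"] letter[of l] eq[of m] unfolding l by (cases "r (i + m)") auto
    ultimately show ?thesis by simp
  qed
  then have "\<exists>N. \<forall>l\<ge>N. r (l + (j - i)) = r l" by blast
  then show ?thesis
    unfolding ultimately_periodic_def r_def[symmetric] using ij(1) zero_less_diff by blast
qed

text \<open>Only finitely many starting values are possible, so one of them serves arbitrarily long
  prefixes, and with these all shorter ones.\<close>

lemma confined_start_uniform:
  assumes "\<And>n. \<exists>s. confined q k s (x [0 \<rightarrow> n])"
  obtains s where "\<And>n. confined q k s (x [0 \<rightarrow> n])"
proof -
  obtain f where f: "confined q k (f n) (x [0 \<rightarrow> n])" for n using assms by metis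
  have "f n \<in> {- k..q - k}" for n
    using f[of n, unfolded confined_def, rule_format, of "[]"] by simp
  then have "finite (range f)"
    by (intro finite_subset[OF _ finite_atLeastAtMost_int[of "- k" "q - k"]]) blast
  then obtain n\<^sub>0 where inf: "infinite {n. f n = f n\<^sub>0}"
    using pigeonhole_infinite[OF infinite_UNIV_nat] by auto
  show thesis
  proof (rule that)
    fix n
    obtain m where m: "n \<le> m" "f m = f n\<^sub>0"
      using inf unfolding infinite_nat_iff_unbounded_le by blast
    have "x [0 \<rightarrow> m] = x [0 \<rightarrow> n] @ x [n \<rightarrow> m]"
      using subsequence_append[of x n "m - n"] m(1) by simp
    then show "confined q k (f n\<^sub>0) (x [0 \<rightarrow> n])"
      using f[of m] unfolding m(2) by (simp add: confined_append)
  qed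
qed

text \<open>By aperiodicity both letters occur. If all values were even, the increments
  \<open>- k\<close> and \<open>q - k\<close> would be even, against coprimality.\<close>

lemma confined_odd_shift:
  assumes "coprime q k" "\<not> ultimately_periodic x" "\<And>n. confined q k s (x [0 \<rightarrow> n])"
  obtains c s' where "odd s'" "\<And>n. confined q k s' (Omega_Words_Fun.suffix c x [0 \<rightarrow> n])"
proof -
  have "\<exists>c. odd (s + disc q k (x [0 \<rightarrow> c]))"
  proof (rule ccontr)
    assume "\<nexists>c. odd (s + disc q k (x [0 \<rightarrow> c]))"
    then have even: "even (s + disc q k (x [0 \<rightarrow> c]))" for c by blast
    have occurs: "\<exists>i. x i = d" for d
    proof (rule ccontr)
      assume "\<nexists>i. x i = d"
      then have "x (i + 1) = x i" for i by (cases "x i"; cases "x (i + 1)"; cases d) metis+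
      then show False using assms(2) unfolding ultimately_periodic_def by (metis zero_less_one)
    qed
    have "even k"
    proof -
      obtain i where "x i = 0" using occurs by blast
      then show ?thesis using even[of i] even[of "Suc i"] by auto
    qed
    moreover have "even (q - k)"
    proof -
      obtain i where "x i = 1" using occurs by blast
      then show ?thesis using even[of i] even[of "Suc i"] by auto
    qed
    ultimately show False using assms(1) by (auto simp: coprime_iff_gcd_eq_1 dest: coprime_common_divisor)
  qed
  then obtain c where c: "odd (s + disc q k (x [0 \<rightarrow> c]))" by blast
  show thesis
  proof (rule that[OF c])
    fix n
    show "confined q k (s + disc q k (x [0 \<rightarrow> c])) (Omega_Words_Fun.suffix c x [0 \<rightarrow> n])"
      using assms(3)[of "c + n"] unfolding subsequence_append confined_append by simp
  qed
qed

section \<open>The dichotomy between bounded and unbounded \<open>q\<close>\<close>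

theorem theorem1p4:
  fixes a b :: nat and \<Omega> :: "bit word set"
  assumes "a \<ge> 1"
    and "minimal_subshift \<Omega>"
    and "aperiodic \<Omega>"
    and "infinite {w \<in> language \<Omega>. solution a b w}"
    and "square_root a b ` \<Omega> \<subseteq> \<Omega>"
  shows "sturmian_subshift \<Omega>"
proof -
  let ?Sol = "{w \<in> language \<Omega>. solution a b w}"
  define P where "P q k w \<longleftrightarrow> 0 \<le> k \<and> (int a + 1) * k \<le> q \<and> 0 < q \<and> coprime q k
    \<and> q \<le> int (length w) \<and> confined q k 0 w" for q k w
  have P: "\<exists>q k. P q k w" if "w \<in> ?Sol" for w
    using solution_confined[OF assms(1), of b w] that unfolding P_def by (metis (lifting) mem_Collect_eq)
  have long: "\<exists>w\<in>A. n \<le> length w" if "infinite A" for A :: "bit list set" and n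
  proof (rule ccontr)
    assume "\<not> ?thesis"
    then have "A \<subseteq> (\<Union>m<n. {w. length w = m})" by force
    then show False using finite_subset finite_length_bit that by blast
  qed
  have subshift: "subshift \<Omega>" using assms(2) unfolding minimal_subshift_def by blast
  have large: "\<exists>w\<in>?Sol. \<exists>q k. P q k w \<and> m \<le> q" for m
  proof (rule ccontr)
    assume "\<not> ?thesis"
    then have small: "q < m" if "w \<in> ?Sol" "P q k w" for w q k using that by force
    \<comment> \<open>Since \<open>k <= q\<close>, a bound on \<open>q\<close> leaves finitely many
      pairs, so one pair belongs to infinitely many solutions, among them arbitrarily long
      ones.\<close>
    have "?Sol \<subseteq> (\<Union>(q, k)\<in>{0..m} \<times> {0..m}. {w \<in> ?Sol. P q k w})"
    proof
      fix w assume w: "w \<in> ?Sol"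
      then obtain q k where qk: "P q k w" using P by blast
      then have "0 \<le> int a * k" "k + int a * k \<le> q" "0 \<le> k" "0 < q"
        unfolding P_def by (simp_all add: algebra_simps)
      moreover from this have "k \<le> q" by linarith
      ultimately have "(q, k) \<in> {0..m} \<times> {0..m}" using small[OF w qk] by auto
      then show "w \<in> (\<Union>(q, k)\<in>{0..m} \<times> {0..m}. {w \<in> ?Sol. P q k w})" using w qk by blast
    qed
    then have "infinite (\<Union>(q, k)\<in>{0..m} \<times> {0..m}. {w \<in> ?Sol. P q k w})"
      using assms(4) finite_subset by blast
    then obtain q k where inf: "infinite {w \<in> ?Sol. P q k w}" by auto
    then obtain w\<^sub>0 where "P q k w\<^sub>0" using not_finite_existsD by blast
    then have qk: "0 \<le> k" "(int a + 1) * k \<le> q" "0 < q" "coprime q k" unfolding P_def by auto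
    \<comment> \<open>Through this every word of the language inherits confinement for the fixed
      pair, and membership in \<open>Lang a b\<close>, from a solution containing it.\<close>
    have in_solution: "\<exists>w\<in>?Sol. P q k w \<and> sublist v w" if v: "v \<in> language \<Omega>" for v
    proof -
      obtain R where "\<And>u. u \<in> language \<Omega> \<Longrightarrow> R \<le> length u \<Longrightarrow> sublist v u"
        using minimal_subshift_recurrent[OF assms(2) v] by blast
      then show ?thesis using long[OF inf, of R] by blast
    qed
    have Lang: "factors w \<subseteq> Lang a b" if "w \<in> \<Omega>" for w
    proof
      fix v assume "v \<in> factors w"
      then have "v \<in> language \<Omega>" using that unfolding language_def by blast
      then obtain u where "solution a b u" "sublist v u" using in_solution by blast
      then have "u @ u \<in> Lang a b" "sublist v (u @ u)"
        unfolding solution_def Pi_lang_def by (auto intro: sublist_appendI sublist_order.order_trans)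
      then show "v \<in> Lang a b" unfolding Lang_def using factors_sublist by blast
    qed
    have "\<exists>x. x \<in> \<Omega>" using in_solution inf not_finite_existsD unfolding language_def by blast
    then obtain x where x: "x \<in> \<Omega>" by blast
    have "\<exists>s. confined q k s (x [0 \<rightarrow> n])" for n
    proof -
      have "x [0 \<rightarrow> n] \<in> language \<Omega>" using x unfolding language_def factors_def by blast
      then show ?thesis using in_solution confined_sublist unfolding P_def by metis
    qed
    then obtain s where "\<And>n. confined q k s (x [0 \<rightarrow> n])" using confined_start_uniform by metis
    then obtain c s' where "odd s'"
      and conf: "\<And>n. confined q k s' (Omega_Words_Fun.suffix c x [0 \<rightarrow> n])"
      using confined_odd_shift[OF qk(4)] assms(3) x unfolding aperiodic_def by metis
    define y where "y = Omega_Words_Fun.suffix c x"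
    have y: "y \<in> \<Omega>" unfolding y_def by (rule subshift_suffix[OF subshift x])
    obtain X where X: "range X \<subseteq> minimal_roots a b" "y = inf_concat (\<lambda>i. X i @ X i)"
      "square_root a b y = inf_concat X"
      using square_root_eq[OF assms(1) Lang[OF y]] .
    have "ultimately_periodic (inf_concat X)"
      using confined_odd_root_periodic[OF assms(1) qk(1,2) X(1) _ \<open>odd s'\<close>] conf
      unfolding X(2)[symmetric] y_def by blast
    moreover have "inf_concat X \<in> \<Omega>" using assms(5) y X(3) by force
    ultimately show False using assms(3) unfolding aperiodic_def by blast
  qed
  have "sturmian w" if w: "w \<in> \<Omega>" for w
  proof (rule sturmianI)
    show "\<not> ultimately_periodic w" using assms(3) w unfolding aperiodic_def by blast
    show "\<not> (0 # z @ [0] \<in> factors w \<and> 1 # z @ [1] \<in> factors w)" for z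
    proof
      assume "0 # z @ [0] \<in> factors w \<and> 1 # z @ [1] \<in> factors w"
      then have "0 # z @ [0] \<in> language \<Omega>" "1 # z @ [1] \<in> language \<Omega>"
        using w unfolding language_def by blast+
      then obtain R\<^sub>0 R\<^sub>1 where R:
        "\<And>u. u \<in> language \<Omega> \<Longrightarrow> R\<^sub>0 \<le> length u \<Longrightarrow> sublist (0 # z @ [0]) u"
        "\<And>u. u \<in> language \<Omega> \<Longrightarrow> R\<^sub>1 \<le> length u \<Longrightarrow> sublist (1 # z @ [1]) u"
        using minimal_subshift_recurrent[OF assms(2)] by metis
      \<comment> \<open>The threshold makes \<open>u\<close> long enough to contain both words,
        since \<open>q\<close> is at most its length, and makes \<open>q\<close> exceed
        \<open>length z + 2\<close>.\<close>
      obtain u q k where u: "u \<in> ?Sol" "P q k u" "int (R\<^sub>0 + R\<^sub>1 + length z + 3) \<le> q"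
        using large by blast
      then have "R\<^sub>0 \<le> length u" "R\<^sub>1 \<le> length u" unfolding P_def by linarith+
      then have "q \<le> int (length z + 2)"
        using confined_balanced[of q k 0 u z] R u unfolding P_def by blast
      then show False using u(3) by simp
    qed
  qed
  then show ?thesis using subshift unfolding sturmian_subshift_def by blast
qed

end
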